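(* Let $G=(V,E)$ be a connected finite graph with positive symmetric edge weights $w_{xy}$ and a measure $\mu:V\to\mathbb{R}^{+}$, and let $h:V\to\mathbb{R}$ be a positive function. Let $$\mathbf{H}=\left\{u\in \mathbf{W}^{1,2}(V)\;\Big|\;\int_V u\,d\mu=0\right\},\qquad J_{\alpha,\beta}(u)=\frac12\int_V\left(|\nabla u|^2-\alpha u^2\right)d\mu-\beta\log\int_V he^u\,d\mu ,$$ and let $\lambda_1(V)$ be the first non-zero eigenvalue of $-\Delta$. Then for any $\alpha<\lambda_1(V)$ and any $\beta\in\mathbb{R}$, $J_{\alpha,\beta}$ has a minimizer in $\mathbf{H}$, i.e. there is $u\in\mathbf{H}$ with $J_{\alpha,\beta}(u)=\inf_{v\in\mathbf{H}}J_{\alpha,\beta}(v)$. Moreover, the Kazdan-Warner equation $$\Delta u+\alpha u=-\frac{\beta he^{u}}{\int_V he^{u}\,d\mu}+\frac{\beta}{\mathrm{Vol}(V)}\quad\text{on } V$$ has a solution $u\in\mathbf{H}$.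
   Context: $G=(V,E)$ is a finite connected graph (with at least two vertices, so that $-\Delta$ has a non-zero eigenvalue); each edge $xy\in E$ has a weight $w_{xy}>0$ with $w_{xy}=w_{yx}$; $y\sim x$ means $xy\in E$; $\mu:V\to\mathbb{R}^{+}$ is a positive finite measure. For $u:V\to\mathbb{R}$, $$\Delta u(x)=\frac{1}{\mu(x)}\sum_{y\sim x}w_{xy}[u(y)-u(x)],\qquad |\nabla u|(x)=\left\{\frac{1}{2\mu(x)}\sum_{y\sim x}w_{xy}[u(y)-u(x)]^2\right\}^{1/2}.$$ For $g:V\to\mathbb{R}$, $\int_V g\,d\mu=\sum_{x\in V}\mu(x)g(x)$, and $\mathrm{Vol}(V)=\sum_{x\in V}\mu(x)$. The Sobolev space is $\mathbf{W}^{1,2}(V)=\{u:V\to\mathbb{R}\mid\int_V(|\nabla u|^2+u^2)\,d\mu<+\infty\}$ (since $V$ is finite, this is the space of all functions on $V$). The first non-zero eigenvalue is $$\lambda_1(V)=\inf_{u\in\mathbf{H},\ \int_V u^2\,d\mu=1}\int_V|\nabla u|^2\,d\mu .$$ *)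

theory Defs
  imports "HOL-Analysis.Analysis" "Graph_Theory.Digraph_Component"
begin

text \<open>
  Finite simple graphs are the symmetric, loop-free, finite digraphs
  \<^locale>\<open>pair_graph\<close>: every edge \<open>xy\<close> is present as the two arcs \<open>(x, y)\<close> and
  \<open>(y, x)\<close>. A weight is a binary function that matters only on arcs; a measure is given by
  its point masses. A function on the vertex set is extensional, i.e. an element of
  \<open>pverts G \<rightarrow>\<^sub>E UNIV\<close>.
\<close>

definition vint :: "'a pair_pre_digraph \<Rightarrow> ('a \<Rightarrow> real) \<Rightarrow> ('a \<Rightarrow> real) \<Rightarrow> real" where
  "vint G \<mu> g = (\<Sum>x\<in>pverts G. \<mu> x * g x)"

definition vol :: "'a pair_pre_digraph \<Rightarrow> ('a \<Rightarrow> real) \<Rightarrow> real" where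
  "vol G \<mu> = (\<Sum>x\<in>pverts G. \<mu> x)"

definition nbrs :: "'a pair_pre_digraph \<Rightarrow> 'a \<Rightarrow> 'a set" where
  "nbrs G x = {y. (x, y) \<in> parcs G}"

definition laplacian ::
  "'a pair_pre_digraph \<Rightarrow> ('a \<Rightarrow> 'a \<Rightarrow> real) \<Rightarrow> ('a \<Rightarrow> real) \<Rightarrow> ('a \<Rightarrow> real) \<Rightarrow> 'a \<Rightarrow> real" where
  "laplacian G w \<mu> u x = (1 / \<mu> x) * (\<Sum>y\<in>nbrs G x. w x y * (u y - u x))"

definition grad_norm ::
  "'a pair_pre_digraph \<Rightarrow> ('a \<Rightarrow> 'a \<Rightarrow> real) \<Rightarrow> ('a \<Rightarrow> real) \<Rightarrow> ('a \<Rightarrow> real) \<Rightarrow> 'a \<Rightarrow> real" where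
  "grad_norm G w \<mu> u x = sqrt ((1 / (2 * \<mu> x)) * (\<Sum>y\<in>nbrs G x. w x y * (u y - u x)\<^sup>2))"

text \<open>
  The integrability condition is vacuous on a finite graph, so that the Sobolev space consists
  of all functions on the vertex set.
\<close>

definition sobolev12 ::
  "'a pair_pre_digraph \<Rightarrow> ('a \<Rightarrow> 'a \<Rightarrow> real) \<Rightarrow> ('a \<Rightarrow> real) \<Rightarrow> ('a \<Rightarrow> real) set" where
  "sobolev12 G w \<mu> =
     {u \<in> pverts G \<rightarrow>\<^sub>E UNIV. ereal (vint G \<mu> (\<lambda>x. (grad_norm G w \<mu> u x)\<^sup>2 + (u x)\<^sup>2)) < \<infinity>}"

definition mean_zero_space ::
  "'a pair_pre_digraph \<Rightarrow> ('a \<Rightarrow> 'a \<Rightarrow> real) \<Rightarrow> ('a \<Rightarrow> real) \<Rightarrow> ('a \<Rightarrow> real) set" where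
  "mean_zero_space G w \<mu> = {u \<in> sobolev12 G w \<mu>. vint G \<mu> u = 0}"

text \<open>
  The infimum below is over a set of reals that is bounded below by \<open>0\<close> and, for at least two
  vertices, nonempty.
\<close>

definition lambda1 ::
  "'a pair_pre_digraph \<Rightarrow> ('a \<Rightarrow> 'a \<Rightarrow> real) \<Rightarrow> ('a \<Rightarrow> real) \<Rightarrow> real" where
  "lambda1 G w \<mu> =
     (INF u \<in> {u \<in> mean_zero_space G w \<mu>. vint G \<mu> (\<lambda>x. (u x)\<^sup>2) = 1}.
        vint G \<mu> (\<lambda>x. (grad_norm G w \<mu> u x)\<^sup>2))"

definition J ::
  "'a pair_pre_digraph \<Rightarrow> ('a \<Rightarrow> 'a \<Rightarrow> real) \<Rightarrow> ('a \<Rightarrow> real) \<Rightarrow> ('a \<Rightarrow> real) \<Rightarrow>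
     real \<Rightarrow> real \<Rightarrow> ('a \<Rightarrow> real) \<Rightarrow> real" where
  "J G w \<mu> h \<alpha> \<beta> u =
     1 / 2 * vint G \<mu> (\<lambda>x. (grad_norm G w \<mu> u x)\<^sup>2 - \<alpha> * (u x)\<^sup>2)
       - \<beta> * ln (vint G \<mu> (\<lambda>x. h x * exp (u x)))"

end

theory Submission
  imports Defs
begin

text \<open>
  The first half is the direct method of the calculus of variations. By the variational definition
  of \<open>\<lambda>\<^sub>1\<close>, every mean zero function satisfies the Poincare inequality
  \<open>\<lambda>\<^sub>1 \<integral> u\<^sup>2 \<le> \<integral> |\<nabla>u|\<^sup>2\<close>, so for \<open>\<alpha> < \<lambda>\<^sub>1\<close> the quadratic part of the functional
  dominates a positive multiple of \<open>\<integral> u\<^sup>2\<close>, hence of \<open>M\<^sup>2\<close> where \<open>M = max |u|\<close>. The logarithmic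
  part differs from the constant \<open>\<beta> log \<integral> h\<close> by at most \<open>|\<beta>| M\<close>, whatever the sign of \<open>\<beta>\<close>,
  because \<open>e\<^sup>-\<^sup>M \<integral> h \<le> \<integral> h e\<^sup>u \<le> e\<^sup>M \<integral> h\<close>. Thus the functional exceeds its value at \<open>0\<close>
  outside a box \<open>|u| \<le> R\<close> (lemma \<open>J_coercive\<close>). On the box it is a continuous function on a compact
  set, so it attains a minimum there, which is a minimum over the whole space
  (lemma \<open>minimizer_exists\<close>).

  The second half shows that a minimizer \<open>u\<close> solves the equation. Let \<open>r\<close> be the difference of the
  two sides of the equation at \<open>u\<close>. By Green's formula, the derivative of the functional at \<open>u\<close> in
  a mean zero direction \<open>\<phi>\<close> is \<open>-\<integral> r \<phi>\<close>, so \<open>r\<close> is orthogonal to all mean zero functions. The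
  constant \<open>\<beta> / Vol(V)\<close> is exactly what makes \<open>r\<close> itself a mean zero function, so that \<open>r\<close> may be
  tested against itself: \<open>\<integral> r\<^sup>2 = 0\<close> (lemma \<open>minimizer_solves\<close>).
\<close>

section \<open>Integration on a finite weighted graph\<close>

lemma vint_cong:
  assumes "\<And>x. x \<in> pverts G \<Longrightarrow> f x = g x"
  shows "vint G \<mu> f = vint G \<mu> g"
  using assms by (simp add: vint_def)

lemma vint_add: "vint G \<mu> (\<lambda>x. f x + g x) = vint G \<mu> f + vint G \<mu> g"
  by (simp add: vint_def sum.distrib algebra_simps)

lemma vint_diff: "vint G \<mu> (\<lambda>x. f x - g x) = vint G \<mu> f - vint G \<mu> g"
  by (simp add: vint_def sum_subtractf algebra_simps)

lemma vint_cmult: "vint G \<mu> (\<lambda>x. c * f x) = c * vint G \<mu> f"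
  by (simp add: vint_def sum_distrib_left algebra_simps)

lemma continuous_on_vint:
  assumes "\<And>x. continuous_on S (\<lambda>u. F u x)"
  shows "continuous_on S (\<lambda>u. vint G \<mu> (F u))"
  unfolding vint_def by (intro continuous_intros assms)

lemma mem_mean_zero_space:
  "u \<in> mean_zero_space G w \<mu> \<longleftrightarrow> u \<in> extensional (pverts G) \<and> vint G \<mu> u = 0"
  by (simp add: mean_zero_space_def sobolev12_def PiE_def)

lemma restrict_mean_zero:
  "restrict u (pverts G) \<in> mean_zero_space G w \<mu> \<longleftrightarrow> vint G \<mu> u = 0"
  using vint_cong[of G "restrict u (pverts G)" u \<mu>] by (simp add: mem_mean_zero_space)

locale weighted_graph = pair_graph G for G :: "'a pair_pre_digraph" +
  fixes w :: "'a \<Rightarrow> 'a \<Rightarrow> real" and \<mu> :: "'a \<Rightarrow> real"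
  assumes nonempty: "pverts G \<noteq> {}"
    and w_pos: "\<And>x y. (x, y) \<in> parcs G \<Longrightarrow> w x y > 0"
    and w_sym: "\<And>x y. (x, y) \<in> parcs G \<Longrightarrow> w x y = w y x"
    and \<mu>_pos: "\<And>x. x \<in> pverts G \<Longrightarrow> \<mu> x > 0"
begin

lemma vint_mono:
  assumes "\<And>x. x \<in> pverts G \<Longrightarrow> f x \<le> g x"
  shows "vint G \<mu> f \<le> vint G \<mu> g"
  unfolding vint_def
  by (intro sum_mono mult_left_mono assms) (auto intro: less_imp_le \<mu>_pos)

lemma vint_nonneg:
  assumes "\<And>x. x \<in> pverts G \<Longrightarrow> 0 \<le> f x"
  shows "0 \<le> vint G \<mu> f"
  unfolding vint_def by (intro sum_nonneg mult_nonneg_nonneg assms) (auto intro: less_imp_le \<mu>_pos)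

lemma vint_pos:
  assumes "\<And>x. x \<in> pverts G \<Longrightarrow> 0 < f x"
  shows "0 < vint G \<mu> f"
  unfolding vint_def
  by (intro sum_pos pair_finite_verts nonempty mult_pos_pos assms \<mu>_pos)

lemma vint_square_ge:
  assumes "x \<in> pverts G"
  shows "\<mu> x * (u x)\<^sup>2 \<le> vint G \<mu> (\<lambda>x. (u x)\<^sup>2)"
  unfolding vint_def
  using assms pair_finite_verts \<mu>_pos
  by (intro member_le_sum[where f = "\<lambda>x. \<mu> x * (u x)\<^sup>2"]) (auto intro!: mult_nonneg_nonneg intro: less_imp_le)

lemma vint_square_eq_0D:
  assumes "vint G \<mu> (\<lambda>x. (u x)\<^sup>2) = 0" "x \<in> pverts G"
  shows "u x = 0"
proof -
  have "\<mu> x * (u x)\<^sup>2 \<le> 0" using vint_square_ge[of x u] assms by simp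
  then show ?thesis using \<mu>_pos[OF assms(2)] by (simp add: mult_le_0_iff)
qed

section \<open>The Dirichlet form and Green's formula\<close>

text \<open>
  The bilinear form that polarizes the energy \<open>\<integral> |\<nabla>u|\<^sup>2\<close>; every edge contributes twice, once per
  arc, which the factor \<open>1/2\<close> corrects.
\<close>

definition dirichlet :: "('a \<Rightarrow> real) \<Rightarrow> ('a \<Rightarrow> real) \<Rightarrow> real" where
  "dirichlet u v = 1 / 2 * (\<Sum>x\<in>pverts G. \<Sum>y\<in>nbrs G x. w x y * (u y - u x) * (v y - v x))"

lemma nbrs_eq: "nbrs G x = {y \<in> pverts G. (x, y) \<in> parcs G}"
  by (auto simp: nbrs_def dest: in_arcsD2)

lemma arc_swap: "(x, y) \<in> parcs G \<longleftrightarrow> (y, x) \<in> parcs G"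
  using arcs_symmetric by blast

lemma sum_arcs_swap:
  fixes f :: "'a \<Rightarrow> 'a \<Rightarrow> real"
  shows "(\<Sum>x\<in>pverts G. \<Sum>y\<in>nbrs G x. f x y) = (\<Sum>x\<in>pverts G. \<Sum>y\<in>nbrs G x. f y x)"
proof -
  have "(\<Sum>x\<in>pverts G. \<Sum>y\<in>nbrs G x. f x y)
      = (\<Sum>y\<in>pverts G. \<Sum>x | x \<in> pverts G \<and> (x, y) \<in> parcs G. f x y)"
    unfolding nbrs_eq by (rule sum.swap_restrict[OF pair_finite_verts pair_finite_verts])
  also have "\<dots> = (\<Sum>y\<in>pverts G. \<Sum>x\<in>nbrs G y. f x y)"
    unfolding nbrs_eq by (intro sum.cong refl) (use arc_swap in blast)
  finally show ?thesis .
qed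

lemma energy_eq_dirichlet: "vint G \<mu> (\<lambda>x. (grad_norm G w \<mu> u x)\<^sup>2) = dirichlet u u"
proof -
  have "\<mu> x * (grad_norm G w \<mu> u x)\<^sup>2 = 1 / 2 * (\<Sum>y\<in>nbrs G x. w x y * (u y - u x) * (u y - u x))"
    if x: "x \<in> pverts G" for x
  proof -
    have "0 \<le> (\<Sum>y\<in>nbrs G x. w x y * (u y - u x)\<^sup>2)"
      by (intro sum_nonneg mult_nonneg_nonneg) (auto simp: nbrs_def intro: less_imp_le w_pos)
    then show ?thesis
      using \<mu>_pos[OF x] unfolding grad_norm_def
      by (simp add: power2_eq_square[of "_ - _"] mult.assoc)
  qed
  then show ?thesis
    by (simp add: vint_def dirichlet_def sum_distrib_left)
qed

text \<open>
  Summation by parts: the two arcs of an edge turn the factor \<open>v y\<close> into \<open>- v x\<close>, since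
  \<open>w x y * (u y - u x)\<close> changes sign when the arc is reversed.
\<close>

lemma green_formula: "dirichlet u v = - vint G \<mu> (\<lambda>x. v x * laplacian G w \<mu> u x)"
proof -
  let ?f = "\<lambda>x y. w x y * (u y - u x)"
  have "(\<Sum>x\<in>pverts G. \<Sum>y\<in>nbrs G x. ?f x y * v y)
      = (\<Sum>x\<in>pverts G. \<Sum>y\<in>nbrs G x. ?f y x * v x)"
    by (rule sum_arcs_swap)
  also have "\<dots> = (\<Sum>x\<in>pverts G. \<Sum>y\<in>nbrs G x. - (?f x y * v x))"
  proof (intro sum.cong refl)
    fix x y assume "y \<in> nbrs G x"
    then have "w y x = w x y" using w_sym[of x y] by (simp add: nbrs_def)
    then show "?f y x * v x = - (?f x y * v x)" by (simp add: algebra_simps)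
  qed
  finally have swap: "(\<Sum>x\<in>pverts G. \<Sum>y\<in>nbrs G x. ?f x y * v y)
      = - (\<Sum>x\<in>pverts G. \<Sum>y\<in>nbrs G x. ?f x y * v x)"
    by (simp add: sum_negf)
  have "dirichlet u v = 1 / 2 * ((\<Sum>x\<in>pverts G. \<Sum>y\<in>nbrs G x. ?f x y * v y)
      - (\<Sum>x\<in>pverts G. \<Sum>y\<in>nbrs G x. ?f x y * v x))"
    unfolding dirichlet_def by (simp add: right_diff_distrib sum_subtractf)
  also have "\<dots> = - (\<Sum>x\<in>pverts G. \<Sum>y\<in>nbrs G x. ?f x y * v x)"
    unfolding swap by simp
  also have "(\<Sum>x\<in>pverts G. \<Sum>y\<in>nbrs G x. ?f x y * v x)
      = vint G \<mu> (\<lambda>x. v x * laplacian G w \<mu> u x)"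
    unfolding vint_def laplacian_def
  proof (intro sum.cong refl)
    fix x assume "x \<in> pverts G"
    with \<mu>_pos[of x]
    show "(\<Sum>y\<in>nbrs G x. ?f x y * v x) = \<mu> x * (v x * (1 / \<mu> x * (\<Sum>y\<in>nbrs G x. ?f x y)))"
      by (simp add: sum_distrib_right[symmetric])
  qed
  finally show ?thesis .
qed

lemma vint_laplacian: "vint G \<mu> (laplacian G w \<mu> u) = 0"
  using green_formula[of u "\<lambda>_. 1"] by (simp add: dirichlet_def)

lemma dirichlet_cong:
  assumes "\<And>x. x \<in> pverts G \<Longrightarrow> u x = u' x" "\<And>x. x \<in> pverts G \<Longrightarrow> v x = v' x"
  shows "dirichlet u v = dirichlet u' v'"
  unfolding dirichlet_def using assms by (auto simp: nbrs_eq intro!: sum.cong)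

lemma dirichlet_nonneg: "0 \<le> dirichlet u u"
  unfolding energy_eq_dirichlet[symmetric] by (intro vint_nonneg) simp

lemma dirichlet_scale: "dirichlet (\<lambda>x. c * u x) (\<lambda>x. c * u x) = c\<^sup>2 * dirichlet u u"
  unfolding dirichlet_def
  by (simp add: sum_distrib_left power2_eq_square algebra_simps)

lemma dirichlet_perturb:
  "dirichlet (\<lambda>x. u x + t * v x) (\<lambda>x. u x + t * v x)
     = dirichlet u u + 2 * t * dirichlet u v + t\<^sup>2 * dirichlet v v"
  unfolding dirichlet_def
  by (simp add: sum_distrib_left sum.distrib[symmetric] power2_eq_square algebra_simps)

lemma continuous_on_dirichlet: "continuous_on S (\<lambda>u. dirichlet u u)"
  unfolding dirichlet_def
  by (intro continuous_intros continuous_on_product_coordinates[THEN continuous_on_subset] subset_UNIV)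

section \<open>The Poincare inequality\<close>

text \<open>
  The infimum that defines \<open>\<lambda>\<^sub>1\<close> is over functions of norm 1; the energy is homogeneous of degree 2,
  so normalizing \<open>u\<close> gives the inequality for all mean zero functions.
\<close>

lemma poincare:
  assumes "u \<in> mean_zero_space G w \<mu>"
  shows "lambda1 G w \<mu> * vint G \<mu> (\<lambda>x. (u x)\<^sup>2) \<le> dirichlet u u"
proof (cases "vint G \<mu> (\<lambda>x. (u x)\<^sup>2) = 0")
  case True
  then show ?thesis using dirichlet_nonneg by simp
next
  case False
  define N where "N = vint G \<mu> (\<lambda>x. (u x)\<^sup>2)"
  have N: "N > 0" using False vint_nonneg[of "\<lambda>x. (u x)\<^sup>2"] by (simp add: N_def)
  define c where "c = 1 / sqrt N"
  have c2: "c\<^sup>2 = 1 / N" using N by (simp add: c_def power_divide)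
  define v where "v = restrict (\<lambda>x. c * u x) (pverts G)"
  have "vint G \<mu> u = 0" using assms by (simp add: mem_mean_zero_space)
  then have vH: "v \<in> mean_zero_space G w \<mu>"
    by (simp add: v_def restrict_mean_zero vint_cmult)
  have "vint G \<mu> (\<lambda>x. (v x)\<^sup>2) = vint G \<mu> (\<lambda>x. c\<^sup>2 * (u x)\<^sup>2)"
    by (intro vint_cong) (simp add: v_def power_mult_distrib)
  also have "\<dots> = 1" unfolding vint_cmult c2 using N by (simp flip: N_def)
  finally have v1: "vint G \<mu> (\<lambda>x. (v x)\<^sup>2) = 1" .
  have "lambda1 G w \<mu> \<le> vint G \<mu> (\<lambda>x. (grad_norm G w \<mu> v x)\<^sup>2)"
    unfolding lambda1_def
  proof (rule cINF_lower)
    show "bdd_below ((\<lambda>u. vint G \<mu> (\<lambda>x. (grad_norm G w \<mu> u x)\<^sup>2)) `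
        {u \<in> mean_zero_space G w \<mu>. vint G \<mu> (\<lambda>x. (u x)\<^sup>2) = 1})"
      by (rule bdd_belowI[of _ 0]) (auto intro: vint_nonneg)
  qed (use vH v1 in simp)
  also have "\<dots> = dirichlet (\<lambda>x. c * u x) (\<lambda>x. c * u x)"
    unfolding energy_eq_dirichlet by (intro dirichlet_cong) (simp_all add: v_def)
  also have "\<dots> = dirichlet u u / N" by (simp add: dirichlet_scale c2)
  finally show ?thesis using N by (simp add: field_simps N_def)
qed

end

section \<open>Existence of a minimizer\<close>

locale kazdan_warner = weighted_graph +
  fixes h :: "'a \<Rightarrow> real"
  assumes h_pos: "\<And>x. x \<in> pverts G \<Longrightarrow> h x > 0"
begin

lemma J_eq:
  "J G w \<mu> h \<alpha> \<beta> u = 1 / 2 * (dirichlet u u - \<alpha> * vint G \<mu> (\<lambda>x. (u x)\<^sup>2))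
     - \<beta> * ln (vint G \<mu> (\<lambda>x. h x * exp (u x)))"
  by (simp add: J_def vint_diff vint_cmult energy_eq_dirichlet)

lemma J_cong:
  assumes "\<And>x. x \<in> pverts G \<Longrightarrow> u x = v x"
  shows "J G w \<mu> h \<alpha> \<beta> u = J G w \<mu> h \<alpha> \<beta> v"
  unfolding J_eq using dirichlet_cong[OF assms assms] assms
  by (simp cong: vint_cong)

lemma vint_exp_pos: "0 < vint G \<mu> (\<lambda>x. h x * exp (u x))"
  by (intro vint_pos) (simp add: h_pos)

text \<open>
  The logarithm of \<open>e\<^sup>-\<^sup>M \<integral> h \<le> \<integral> h e\<^sup>u \<le> e\<^sup>M \<integral> h\<close>; the bound is needed from both sides because
  \<open>\<beta>\<close> may have either sign.
\<close>

lemma log_vint_exp_bound: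
  assumes "\<And>x. x \<in> pverts G \<Longrightarrow> \<bar>u x\<bar> \<le> M"
  shows "\<bar>ln (vint G \<mu> (\<lambda>x. h x * exp (u x))) - ln (vint G \<mu> h)\<bar> \<le> M"
proof -
  let ?I = "vint G \<mu> (\<lambda>x. h x * exp (u x))"
  have h: "vint G \<mu> h > 0" by (intro vint_pos h_pos)
  have "?I \<le> vint G \<mu> (\<lambda>x. exp M * h x)"
    using assms h_pos by (intro vint_mono) (fastforce simp: abs_le_iff intro: less_imp_le)
  then have "?I \<le> exp M * vint G \<mu> h" by (simp add: vint_cmult)
  then have "ln ?I \<le> ln (exp M * vint G \<mu> h)"
    using vint_exp_pos h by (subst ln_le_cancel_iff) auto
  then have upper: "ln ?I \<le> M + ln (vint G \<mu> h)" using h by (simp add: ln_mult)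
  have "vint G \<mu> (\<lambda>x. exp (- M) * h x) \<le> ?I"
    using assms h_pos by (intro vint_mono) (fastforce simp: abs_le_iff intro: less_imp_le)
  then have "exp (- M) * vint G \<mu> h \<le> ?I" by (simp add: vint_cmult)
  then have "ln (exp (- M) * vint G \<mu> h) \<le> ln ?I"
    using vint_exp_pos h by (subst ln_le_cancel_iff) auto
  then have "- M + ln (vint G \<mu> h) \<le> ln ?I" using h by (simp add: ln_mult)
  with upper show ?thesis by linarith
qed

text \<open>
  With \<open>M = max |u|\<close>, the quadratic part is at least \<open>a * M\<^sup>2\<close> for some \<open>a > 0\<close> and the logarithmic
  part is at most \<open>|\<beta>| * M\<close> away from its value at \<open>0\<close>, so every \<open>M > |\<beta>| / a\<close> will do.
\<close>

lemma J_coercive: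
  assumes "\<alpha> < lambda1 G w \<mu>"
  obtains R where "R \<ge> 0"
    and "\<And>u. u \<in> mean_zero_space G w \<mu> \<Longrightarrow> \<exists>x\<in>pverts G. R < \<bar>u x\<bar>
           \<Longrightarrow> J G w \<mu> h \<alpha> \<beta> (\<lambda>_. 0) < J G w \<mu> h \<alpha> \<beta> u"
proof -
  define m where "m = Min (\<mu> ` pverts G)"
  have m_pos: "m > 0" unfolding m_def
    using pair_finite_verts nonempty \<mu>_pos by (subst Min_gr_iff) auto
  have m_le: "m \<le> \<mu> x" if "x \<in> pverts G" for x
    unfolding m_def using pair_finite_verts that by simp
  define a where "a = (lambda1 G w \<mu> - \<alpha>) * m / 2"
  have a_pos: "a > 0" unfolding a_def using assms m_pos by simp
  show thesis
  proof (rule that[of "\<bar>\<beta>\<bar> / a"])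
    show "\<bar>\<beta>\<bar> / a \<ge> 0" using a_pos by simp
  next
    fix u
    assume u: "u \<in> mean_zero_space G w \<mu>" and big: "\<exists>x\<in>pverts G. \<bar>\<beta>\<bar> / a < \<bar>u x\<bar>"
    define M where "M = Max ((\<lambda>x. \<bar>u x\<bar>) ` pverts G)"
    have "M \<in> (\<lambda>x. \<bar>u x\<bar>) ` pverts G"
      unfolding M_def using pair_finite_verts nonempty by (intro Max_in) auto
    then obtain x0 where x0: "x0 \<in> pverts G" "M = \<bar>u x0\<bar>" by auto
    have M: "\<bar>u x\<bar> \<le> M" if "x \<in> pverts G" for x
      unfolding M_def using pair_finite_verts that by simp
    have "\<bar>\<beta>\<bar> / a < M" using big M by fastforce
    then have M_big: "\<bar>\<beta>\<bar> < a * M" using a_pos by (simp add: field_simps)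
    then have M_pos: "0 < M"
      using a_pos by (smt (verit) zero_less_mult_pos)
    let ?N = "vint G \<mu> (\<lambda>x. (u x)\<^sup>2)"
    let ?L = "ln (vint G \<mu> (\<lambda>x. h x * exp (u x)))"
    have "m * M\<^sup>2 \<le> \<mu> x0 * (u x0)\<^sup>2"
      unfolding x0(2) power2_abs using m_le[OF x0(1)] by (simp add: mult_right_mono)
    also have "\<dots> \<le> ?N" by (rule vint_square_ge[OF x0(1)])
    finally have "(lambda1 G w \<mu> - \<alpha>) * (m * M\<^sup>2) \<le> (lambda1 G w \<mu> - \<alpha>) * ?N"
      using assms by (intro mult_left_mono) auto
    moreover have "(lambda1 G w \<mu> - \<alpha>) * ?N \<le> dirichlet u u - \<alpha> * ?N"
      using poincare[OF u] by (simp add: left_diff_distrib)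
    ultimately have quad: "a * M\<^sup>2 \<le> 1 / 2 * (dirichlet u u - \<alpha> * ?N)"
      by (simp add: a_def)
    have "\<bar>\<beta> * (?L - ln (vint G \<mu> h))\<bar> \<le> \<bar>\<beta>\<bar> * M"
      unfolding abs_mult using log_vint_exp_bound[of u M] M by (intro mult_left_mono) auto
    then have "\<beta> * ?L \<le> \<beta> * ln (vint G \<mu> h) + \<bar>\<beta>\<bar> * M"
      by (simp add: right_diff_distrib abs_le_iff)
    moreover have "\<bar>\<beta>\<bar> * M < a * M\<^sup>2"
      using mult_strict_right_mono[OF M_big M_pos] by (simp add: power2_eq_square mult.assoc)
    ultimately have "- (\<beta> * ln (vint G \<mu> h)) < J G w \<mu> h \<alpha> \<beta> u"
      using quad unfolding J_eq by linarith
    then show "J G w \<mu> h \<alpha> \<beta> (\<lambda>_. 0) < J G w \<mu> h \<alpha> \<beta> u"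
      by (simp add: J_eq dirichlet_def vint_def)
  qed
qed

lemma continuous_on_J: "continuous_on S (J G w \<mu> h \<alpha> \<beta>)"
proof -
  note coord = continuous_on_product_coordinates[THEN continuous_on_subset, OF subset_UNIV]
  have "vint G \<mu> (\<lambda>x. h x * exp (u x)) \<noteq> 0" for u
    using vint_exp_pos[of u] by simp
  then show ?thesis
    unfolding J_eq[abs_def]
    by (intro continuous_intros continuous_on_dirichlet continuous_on_vint coord) simp
qed

text \<open>
  Functions on \<open>V\<close> are here total functions that are \<open>undefined\<close> off \<open>V\<close>, so that a box is a product
  over all of the type of intervals and singletons, and Tychonoff's theorem applies.
\<close>

lemma compact_box: "compact (pverts G \<rightarrow>\<^sub>E {- R..R :: real})"
proof -
  have "pverts G \<rightarrow>\<^sub>E {- R..R} = (\<Pi>\<^sub>E x\<in>UNIV. if x \<in> pverts G then {- R..R} else {undefined})"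
    by (fastforce simp: PiE_iff extensional_def split: if_splits)
  moreover have "compactin (product_topology (\<lambda>_. euclidean) UNIV)
      (\<Pi>\<^sub>E x\<in>UNIV. if x \<in> pverts G then {- R..R} else {undefined})"
    by (auto simp: compactin_PiE)
  ultimately show ?thesis
    by (simp add: euclidean_product_topology)
qed

lemma minimizer_exists:
  assumes "\<alpha> < lambda1 G w \<mu>"
  obtains u where "u \<in> mean_zero_space G w \<mu>"
    and "\<And>v. v \<in> mean_zero_space G w \<mu> \<Longrightarrow> J G w \<mu> h \<alpha> \<beta> u \<le> J G w \<mu> h \<alpha> \<beta> v"
proof -
  obtain R where R: "R \<ge> 0"
    and outside: "\<And>u. u \<in> mean_zero_space G w \<mu> \<Longrightarrow> \<exists>x\<in>pverts G. R < \<bar>u x\<bar>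
           \<Longrightarrow> J G w \<mu> h \<alpha> \<beta> (\<lambda>_. 0) < J G w \<mu> h \<alpha> \<beta> u"
    using J_coercive[OF assms] by blast
  define K where "K = (pverts G \<rightarrow>\<^sub>E {- R..R}) \<inter> {u. vint G \<mu> u = 0}"
  have "closed {u. vint G \<mu> u = 0}"
    by (intro closed_Collect_eq continuous_on_vint continuous_on_const
        continuous_on_product_coordinates)
  then have compact: "compact K" unfolding K_def by (intro compact_Int_closed compact_box)
  define z where "z = restrict (\<lambda>_. 0 :: real) (pverts G)"
  have zK: "z \<in> K" using R vint_cong[of G z "\<lambda>_. 0" \<mu>] by (auto simp: K_def z_def vint_def)
  have Jz: "J G w \<mu> h \<alpha> \<beta> z = J G w \<mu> h \<alpha> \<beta> (\<lambda>_. 0)" by (intro J_cong) (simp add: z_def)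
  obtain u where uK: "u \<in> K" and min: "\<And>v. v \<in> K \<Longrightarrow> J G w \<mu> h \<alpha> \<beta> u \<le> J G w \<mu> h \<alpha> \<beta> v"
    using continuous_attains_inf[OF compact _ continuous_on_J] zK by blast
  show thesis
  proof (rule that[of u])
    show "u \<in> mean_zero_space G w \<mu>"
      using uK by (auto simp: K_def mem_mean_zero_space PiE_def)
    fix v assume v: "v \<in> mean_zero_space G w \<mu>"
    show "J G w \<mu> h \<alpha> \<beta> u \<le> J G w \<mu> h \<alpha> \<beta> v"
    proof (cases "\<exists>x\<in>pverts G. R < \<bar>v x\<bar>")
      case True
      then show ?thesis using outside[OF v True] min[OF zK] Jz by linarith
    next
      case False
      then have "v \<in> K" using v by (force simp: K_def mem_mean_zero_space PiE_def abs_le_iff not_less)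
      then show ?thesis by (rule min)
    qed
  qed
qed

section \<open>The Euler-Lagrange equation\<close>

text \<open>The left-hand side of the equation minus its right-hand side.\<close>

definition residual :: "real \<Rightarrow> real \<Rightarrow> ('a \<Rightarrow> real) \<Rightarrow> 'a \<Rightarrow> real" where
  "residual \<alpha> \<beta> u x = laplacian G w \<mu> u x + \<alpha> * u x
     + \<beta> / vint G \<mu> (\<lambda>y. h y * exp (u y)) * (h x * exp (u x)) - \<beta> / vol G \<mu>"

text \<open>
  The Laplacian integrates to 0 and so does \<open>u\<close>; the other two terms have integrals \<open>\<beta>\<close> and \<open>-\<beta>\<close>.
\<close>

lemma vint_residual:
  assumes "vint G \<mu> u = 0"
  shows "vint G \<mu> (residual \<alpha> \<beta> u) = 0"
proof -
  have "vol G \<mu> > 0" using vint_pos[of "\<lambda>_. 1"] by (simp add: vint_def vol_def)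
  moreover have "vint G \<mu> (\<lambda>_. \<beta> / vol G \<mu>) = \<beta> / vol G \<mu> * vol G \<mu>"
    by (simp add: vint_def vol_def sum_divide_distrib sum_distrib_left mult.commute)
  ultimately show ?thesis
    using vint_exp_pos[of u] assms
    unfolding residual_def[abs_def] vint_diff vint_add vint_cmult
    by (simp add: vint_laplacian)
qed

text \<open>
  Green's formula moves the derivative of the energy from \<open>\<phi>\<close> to \<open>u\<close>, which gives \<open>\<Delta>u\<close> in the
  residual. A constant may be added to the residual freely as \<open>\<phi>\<close> has mean zero; this is where
  \<open>\<beta> / Vol(V)\<close>, the Lagrange multiplier of the constraint \<open>\<integral> u = 0\<close>, comes from.
\<close>

lemma J_directional_derivative:
  assumes \<phi>: "vint G \<mu> \<phi> = 0"
  shows "((\<lambda>t. J G w \<mu> h \<alpha> \<beta> (\<lambda>x. u x + t * \<phi> x)) has_real_derivative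
           - vint G \<mu> (\<lambda>x. residual \<alpha> \<beta> u x * \<phi> x)) (at 0)"
proof -
  let ?I = "vint G \<mu> (\<lambda>x. h x * exp (u x))"
  have sq: "vint G \<mu> (\<lambda>x. (u x + t * \<phi> x)\<^sup>2) = vint G \<mu> (\<lambda>x. (u x)\<^sup>2)
      + 2 * t * vint G \<mu> (\<lambda>x. u x * \<phi> x) + t\<^sup>2 * vint G \<mu> (\<lambda>x. (\<phi> x)\<^sup>2)" for t
    by (simp add: vint_add[symmetric] vint_cmult[symmetric] power2_eq_square algebra_simps)
  have expI: "((\<lambda>t. vint G \<mu> (\<lambda>x. h x * exp (u x + t * \<phi> x))) has_real_derivative
      vint G \<mu> (\<lambda>x. h x * exp (u x) * \<phi> x)) (at 0)"
    unfolding vint_def by (auto intro!: derivative_eq_intros sum.cong simp: algebra_simps)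
  have "((\<lambda>t. J G w \<mu> h \<alpha> \<beta> (\<lambda>x. u x + t * \<phi> x)) has_real_derivative
      (dirichlet u \<phi> - \<alpha> * vint G \<mu> (\<lambda>x. u x * \<phi> x)
        - \<beta> * (vint G \<mu> (\<lambda>x. h x * exp (u x) * \<phi> x) / ?I))) (at 0)"
    unfolding J_eq dirichlet_perturb sq
    using vint_exp_pos[of u]
    by (auto intro!: derivative_eq_intros expI simp: field_simps)
  moreover have "- vint G \<mu> (\<lambda>x. residual \<alpha> \<beta> u x * \<phi> x)
      = dirichlet u \<phi> - \<alpha> * vint G \<mu> (\<lambda>x. u x * \<phi> x)
        - \<beta> * (vint G \<mu> (\<lambda>x. h x * exp (u x) * \<phi> x) / ?I)"
  proof -
    have "residual \<alpha> \<beta> u x * \<phi> x = \<phi> x * laplacian G w \<mu> u x + \<alpha> * (u x * \<phi> x)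
        + \<beta> / ?I * (h x * exp (u x) * \<phi> x) - \<beta> / vol G \<mu> * \<phi> x" for x
      by (simp add: residual_def algebra_simps)
    then have "vint G \<mu> (\<lambda>x. residual \<alpha> \<beta> u x * \<phi> x)
        = - dirichlet u \<phi> + \<alpha> * vint G \<mu> (\<lambda>x. u x * \<phi> x)
          + \<beta> / ?I * vint G \<mu> (\<lambda>x. h x * exp (u x) * \<phi> x) - \<beta> / vol G \<mu> * vint G \<mu> \<phi>"
      by (simp only: vint_diff vint_add vint_cmult green_formula minus_minus)
    then show ?thesis using \<phi> by simp
  qed
  ultimately show ?thesis by simp
qed

text \<open>
  The residual is an admissible direction by \<open>vint_residual\<close>, and the derivative in that direction
  is minus its squared norm.
\<close>

lemma minimizer_solves:
  assumes u: "u \<in> mean_zero_space G w \<mu>"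
    and min: "\<And>v. v \<in> mean_zero_space G w \<mu> \<Longrightarrow> J G w \<mu> h \<alpha> \<beta> u \<le> J G w \<mu> h \<alpha> \<beta> v"
    and x: "x \<in> pverts G"
  shows "residual \<alpha> \<beta> u x = 0"
proof -
  let ?r = "residual \<alpha> \<beta> u"
  have u0: "vint G \<mu> u = 0" using u by (simp add: mem_mean_zero_space)
  have r0: "vint G \<mu> ?r = 0" by (rule vint_residual[OF u0])
  have le: "J G w \<mu> h \<alpha> \<beta> (\<lambda>x. u x + 0 * ?r x) \<le> J G w \<mu> h \<alpha> \<beta> (\<lambda>x. u x + t * ?r x)" for t
  proof -
    have "restrict (\<lambda>x. u x + t * ?r x) (pverts G) \<in> mean_zero_space G w \<mu>"
      using u0 r0 by (simp add: restrict_mean_zero vint_add vint_cmult)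
    from min[OF this] show ?thesis
      by (simp add: J_cong[of "restrict _ (pverts G)" "\<lambda>x. u x + t * ?r x"])
  qed
  \<comment> \<open>the line \<open>u + t r\<close> stays admissible for all \<open>t\<close>, so 1 is an arbitrary radius of minimality\<close>
  have "- vint G \<mu> (\<lambda>x. ?r x * ?r x) = 0"
    by (rule DERIV_local_min[OF J_directional_derivative[OF r0], of 1]) (use le in auto)
  then show ?thesis
    using vint_square_eq_0D[of ?r x] x by (simp add: power2_eq_square)
qed

end

section \<open>Minimizers and solutions of the Kazdan-Warner equation\<close>

theorem theorem2p2:
  fixes G :: "'a pair_pre_digraph"
    and w :: "'a \<Rightarrow> 'a \<Rightarrow> real"
    and \<mu> h :: "'a \<Rightarrow> real"
    and \<alpha> \<beta> :: real
  assumes graph: "pair_graph G"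
    and conn: "Digraph_Component.connected (with_proj G)"
    and card: "card (pverts G) \<ge> 2"
    and w_pos: "\<And>x y. (x, y) \<in> parcs G \<Longrightarrow> w x y > 0"
    and w_sym: "\<And>x y. (x, y) \<in> parcs G \<Longrightarrow> w x y = w y x"
    and \<mu>_pos: "\<And>x. x \<in> pverts G \<Longrightarrow> \<mu> x > 0"
    and h_pos: "\<And>x. x \<in> pverts G \<Longrightarrow> h x > 0"
    and \<alpha>_less: "\<alpha> < lambda1 G w \<mu>"
  shows "(\<exists>u \<in> mean_zero_space G w \<mu>.
            ereal (J G w \<mu> h \<alpha> \<beta> u) = (INF v \<in> mean_zero_space G w \<mu>. ereal (J G w \<mu> h \<alpha> \<beta> v)))
       \<and> (\<exists>u \<in> mean_zero_space G w \<mu>. \<forall>x \<in> pverts G.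
            laplacian G w \<mu> u x + \<alpha> * u x =
              - (\<beta> * h x * exp (u x)) / vint G \<mu> (\<lambda>y. h y * exp (u y)) + \<beta> / vol G \<mu>)"
proof -
  interpret pair_graph G by (rule graph)
  interpret kazdan_warner G w \<mu> h
    using card w_pos w_sym \<mu>_pos h_pos by unfold_locales auto
  obtain u where u: "u \<in> mean_zero_space G w \<mu>"
    and min: "\<And>v. v \<in> mean_zero_space G w \<mu> \<Longrightarrow> J G w \<mu> h \<alpha> \<beta> u \<le> J G w \<mu> h \<alpha> \<beta> v"
    using minimizer_exists[OF \<alpha>_less] by blast
  have "ereal (J G w \<mu> h \<alpha> \<beta> u) = (INF v \<in> mean_zero_space G w \<mu>. ereal (J G w \<mu> h \<alpha> \<beta> v))"
    using u min by (intro antisym INF_greatest INF_lower) auto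
  moreover have "laplacian G w \<mu> u x + \<alpha> * u x =
      - (\<beta> * h x * exp (u x)) / vint G \<mu> (\<lambda>y. h y * exp (u y)) + \<beta> / vol G \<mu>"
    if "x \<in> pverts G" for x
    using minimizer_solves[OF u min that] by (simp add: residual_def algebra_simps)
  ultimately show ?thesis using u by blast
qed

end
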